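(* The generating function $R(x)=\sum_{n\geq 0}|I_n(100,012)|\,x^{n+1}$ is given by $$R(x)=\frac{x(x^6-x^5-3x^4+x^3+3x^2-3x+1)}{(1-x)^3(1-x-x^2)^2}=x+2x^2+5x^3+12x^4+27x^5+56x^6+110x^7+207x^8+378x^9+675x^{10}+\cdots.$$ Moreover, for all $n\geq 0$, $$|I_n(100,012)|=\frac{(n+7)\,\mathrm{Fib}_n+15\,\mathrm{Fib}_{n+1}+n\,\mathrm{Fib}_{n+2}}{5}-1-\binom{n+2}{2},$$ where $\mathrm{Fib}_n$ is the $n$th Fibonacci number.
   Context: For $n\ge 0$, $I_n$ denotes the set of inversion sequences $e=e_0e_1\cdots e_n$, i.e. integer sequences with $0\le e_i\le i$ for each $0\le i\le n$ (so elements of $I_n$ have $n+1$ letters). An inversion sequence contains a pattern (word) $\tau$ of length $k$ if it has a subsequence (not necessarily consecutive) of length $k$ that is order isomorphic to $\tau$ (same relative order, including equalities); otherwise it avoids $\tau$. $I_n(\tau_1,\dots,\tau_m)$ is the set of $e\in I_n$ avoiding all of $\tau_1,\dots,\tau_m$. Fibonacci numbers: $\mathrm{Fib}_0=0$, $\mathrm{Fib}_1=1$, $\mathrm{Fib}_n=\mathrm{Fib}_{n-1}+\mathrm{Fib}_{n-2}$.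
   Formalization: The printed closed formula for |I_n(100,012)| is off by one index (at n=1 it gives 1, but the count is 2); the formal statement replaces n by n+1 throughout its right-hand side, in agreement with the generating function. *)

theory Defs
  imports
    "HOL-Library.Sublist"
    "HOL-Computational_Algebra.Formal_Power_Series"
    "HOL-Number_Theory.Fib"
begin

(* The elements of inv_seqs n are e_0 e_1 ... e_n and so have n + 1 letters. *)
definition inv_seqs :: "nat \<Rightarrow> nat list set" where
  "inv_seqs n = {e. length e = n + 1 \<and> (\<forall>i\<le>n. e ! i \<le> i)}"

definition order_isomorphic :: "nat list \<Rightarrow> nat list \<Rightarrow> bool" where
  "order_isomorphic s t \<longleftrightarrow> length s = length t \<and>
     (\<forall>i<length s. \<forall>j<length s.
        (s ! i < s ! j \<longleftrightarrow> t ! i < t ! j) \<and> (s ! i = s ! j \<longleftrightarrow> t ! i = t ! j))"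

definition contains_pattern :: "nat list \<Rightarrow> nat list \<Rightarrow> bool" where
  "contains_pattern e t \<longleftrightarrow> (\<exists>s. subseq s e \<and> order_isomorphic s t)"

definition inv_seqs_avoiding :: "nat \<Rightarrow> nat list set \<Rightarrow> nat list set" where
  "inv_seqs_avoiding n P = {e \<in> inv_seqs n. \<forall>t\<in>P. \<not> contains_pattern e t}"

(* The formal series with coefficient |I_n(P)| at x^(n+1) and constant term 0. *)
definition inv_seqs_gf :: "nat list set \<Rightarrow> rat fps" where
  "inv_seqs_gf P =
     Abs_fps (\<lambda>k. if k = 0 then 0 else of_nat (card (inv_seqs_avoiding (k - 1) P)))"

end

theory Submission
  imports Defs
begin

text \<open>
  An inversion sequence starts with \<open>0\<close>. Hence it avoids \<open>012\<close> iff its positive letters are weakly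
  decreasing. Suppose that it is not constantly \<open>0\<close>, and write it as \<open>0^p m w\<close>, where \<open>m > 0\<close> is the
  first positive letter, so that \<open>1 \<le> m \<le> p\<close>. If it also avoids \<open>100\<close>, then \<open>w\<close> contains at most one
  \<open>0\<close>, and no positive letter below \<open>m\<close> is repeated. So the positive letters of \<open>w\<close> are some copies
  of \<open>m\<close> followed by a strictly decreasing word in letters below \<open>m\<close>, and conversely every such \<open>w\<close>
  occurs (lemma \<open>inv_seqs_avoiding_decomposition\<close>).

  A strictly decreasing word is determined by its set of letters, so with \<open>r = n - p\<close> letters in \<open>w\<close> there are
  \<open>\<Sum>j\<le>r. (m - 1) choose j\<close> choices of \<open>w\<close> without a zero, and \<open>r\<close> times \<open>\<Sum>j<r. (m - 1) choose j\<close>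
  choices with exactly one zero (lemma \<open>card_tails\<close>). Summing over \<open>m\<close> and \<open>p\<close> yields two double sums
  of binomial coefficients \<open>p choose (j + 1)\<close>, with \<open>j \<le> n - p\<close> in the first one and with \<open>j < n - p\<close>
  and an additional factor \<open>n - p\<close> in the second one (lemma \<open>card_inv_seqs_avoiding\<close>).

  When \<open>n\<close> increases by one, the first double sum grows by a sum along a shallow diagonal of
  Pascal's triangle, and the second one by such sums and the first double sum (lemma
  \<open>sum_weighted_partial_binomials_Suc\<close>). Plain diagonal sums are Fibonacci numbers, and those
  weighted by the lower index of the binomial coefficient are Fibonacci numbers with linear coefficients
  (lemma \<open>weighted_diagonal\<close>). This gives the closed form. The closed form satisfies the linear recurrence
  whose characteristic polynomial is the reversed denominator \<open>(1 - x)^3 (1 - x - x^2)^2\<close>, so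
  multiplying the generating function by the denominator leaves a polynomial, determined by the
  first few coefficients (lemma \<open>fps_of_closed_form\<close>).
\<close>

section \<open>Subsequences and the two patterns\<close>

lemma sorted_wrt_iff_subseq:
  "sorted_wrt P xs \<longleftrightarrow> (\<forall>a b. subseq [a, b] xs \<longrightarrow> P a b)"
proof (induction xs)
  case Nil
  then show ?case by simp
next
  case (Cons x xs)
  have "subseq [a, b] (x # xs) \<longleftrightarrow> (a = x \<and> b \<in> set xs) \<or> subseq [a, b] xs" for a b
    by (cases "a = x") (auto simp: subseq_singleton_left subseq_Cons2_neq dest: subseq_Cons')
  with Cons.IH show ?case by auto
qed

lemma subseq_replicate_iff: "subseq (replicate n a) xs \<longleftrightarrow> n \<le> count_list xs a"
proof
  assume "subseq (replicate n a) xs"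
  then have "subseq (filter ((=) a) (replicate n a)) (filter ((=) a) xs)"
    by (rule subseq_filter)
  then have "length (filter ((=) a) (replicate n a)) \<le> length (filter ((=) a) xs)"
    by (rule list_emb_length)
  then show "n \<le> count_list xs a"
    by (simp add: count_list_eq_length_filter)
next
  assume n: "n \<le> count_list xs a"
  have "subseq (replicate (count_list xs a) a) xs"
    unfolding count_list_eq_length_filter replicate_length_filter by simp
  moreover have "prefix (replicate n a) (replicate (count_list xs a) a)"
    using n by (metis le_add_diff_inverse prefixI replicate_add)
  ultimately show "subseq (replicate n a) xs"
    by (meson prefix_imp_subseq subseq_order.order_trans)
qed

lemma subseq_set: "subseq xs ys \<Longrightarrow> set xs \<subseteq> set ys"
  using list_emb_set[of "(=)" xs ys] by blast

lemma subseq_same_two_iff: "subseq [a, a] xs \<longleftrightarrow> 2 \<le> count_list xs a"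
  using subseq_replicate_iff[of 2 a xs] by (simp add: numeral_2_eq_2)

lemma subseq_replicate_append_neq:
  "a \<noteq> c \<Longrightarrow> subseq (a # as) (replicate p c @ xs) \<longleftrightarrow> subseq (a # as) xs"
  by (induction p) (auto simp: subseq_Cons2_neq)

lemma subseq_filter_iff:
  "(\<forall>x\<in>set s. Q x) \<Longrightarrow> subseq s (filter Q xs) \<longleftrightarrow> subseq s xs"
  by (metis filter_True subseq_filter subseq_filter_left subseq_order.order_trans)

lemma order_isomorphic_012_iff:
  "order_isomorphic s [0,1,2] \<longleftrightarrow> (\<exists>a b c. s = [a,b,c] \<and> a < b \<and> b < c)"
proof
  assume s: "order_isomorphic s [0,1,2]"
  then have "length s = 3" by (simp add: order_isomorphic_def)
  then obtain a b c where "s = [a,b,c]"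
    by (auto simp: numeral_3_eq_3 length_Suc_conv)
  with s show "\<exists>a b c. s = [a,b,c] \<and> a < b \<and> b < c"
    by (auto simp: order_isomorphic_def All_less_Suc2)
qed (force simp: order_isomorphic_def All_less_Suc2 numeral_2_eq_2)

lemma order_isomorphic_100_iff:
  "order_isomorphic s [1,0,0] \<longleftrightarrow> (\<exists>a b. s = [b,a,a] \<and> a < b)"
proof
  assume s: "order_isomorphic s [1,0,0]"
  then have "length s = 3" by (simp add: order_isomorphic_def)
  then obtain b a c where abc: "s = [b,a,c]"
    by (auto simp: numeral_3_eq_3 length_Suc_conv)
  from s have iso: "(s ! i < s ! j \<longleftrightarrow> [1,0,0::nat] ! i < [1,0,0] ! j) \<and>
      (s ! i = s ! j \<longleftrightarrow> [1,0,0::nat] ! i = [1,0,0] ! j)" if "i < 3" "j < 3" for i j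
    using that by (simp add: order_isomorphic_def)
  from iso[of 1 0] iso[of 1 2] have "a < b" "a = c" by (simp_all add: abc)
  with abc show "\<exists>a b. s = [b,a,a] \<and> a < b" by blast
qed (force simp: order_isomorphic_def All_less_Suc2 numeral_2_eq_2)

lemma contains_012_iff:
  "contains_pattern e [0,1,2] \<longleftrightarrow> (\<exists>a b c. subseq [a,b,c] e \<and> a < b \<and> b < c)"
  unfolding contains_pattern_def order_isomorphic_012_iff by blast

lemma contains_100_iff:
  "contains_pattern e [1,0,0] \<longleftrightarrow> (\<exists>a b. subseq [b,a,a] e \<and> a < b)"
  unfolding contains_pattern_def order_isomorphic_100_iff by blast

section \<open>Enumeration of the possible tails\<close>

text \<open>Strictly decreasing words of length \<open>r\<close> over the positive letters \<open>1, \<dots>, k\<close>.\<close>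

definition decreasing_words :: "nat \<Rightarrow> nat \<Rightarrow> nat list set" where
  "decreasing_words k r = {u. length u = r \<and> sorted_wrt (>) u \<and> set u \<subseteq> {1..k}}"

text \<open>
  The words of length \<open>r\<close> over positive letters that may follow a first positive letter
  \<open>k + 1\<close> when no zeros are allowed: some repetitions of \<open>k + 1\<close>, then a strictly decreasing word
  in smaller letters. The first letter is written as a successor so that it is visibly positive;
  it is not itself part of the word.
\<close>

definition plateau_words :: "nat \<Rightarrow> nat \<Rightarrow> nat list set" where
  "plateau_words k r =
     {replicate i (Suc k) @ u | i u. i + length u = r \<and> u \<in> decreasing_words k (length u)}"

text \<open>
  The words of length \<open>r\<close> that may follow a first positive letter \<open>k + 1\<close>: at most one letter is
  \<open>0\<close>, and the remaining ones form a plateau word.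
\<close>

definition tails :: "nat \<Rightarrow> nat \<Rightarrow> nat list set" where
  "tails k r = {w. length w = r \<and> count_list w 0 \<le> 1 \<and>
     filter (\<lambda>x. x \<noteq> 0) w \<in> plateau_words k (length (filter (\<lambda>x. x \<noteq> 0) w))}"

lemma plateau_words_bounds:
  "v \<in> plateau_words k r \<Longrightarrow> set v \<subseteq> {1..Suc k}"
  by (force simp: plateau_words_def decreasing_words_def)

lemma finite_decreasing_words: "finite (decreasing_words k r)"
  by (rule finite_subset[OF _ finite_lists_length_eq[of "{1..k}" r]])
     (auto simp: decreasing_words_def)

lemma card_decreasing_words: "card (decreasing_words k r) = k choose r"
proof (induction k arbitrary: r)
  case 0
  have "decreasing_words 0 r = (if r = 0 then {[]} else {})"
    by (auto simp: decreasing_words_def)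
  then show ?case by (simp add: binomial_eq_0)
next
  case (Suc k)
  show ?case
  proof (cases r)
    case 0
    have "decreasing_words (Suc k) 0 = {[]}"
      by (auto simp: decreasing_words_def)
    with 0 show ?thesis by simp
  next
    case (Suc s)
    have split: "decreasing_words (Suc k) (Suc s) =
        (#) (Suc k) ` decreasing_words k s \<union> decreasing_words k (Suc s)" (is "?L = ?R1 \<union> ?R2")
    proof (intro set_eqI iffI)
      fix u assume u: "u \<in> ?L"
      then obtain x v where xv: "u = x # v"
        by (cases u) (auto simp: decreasing_words_def)
      show "u \<in> ?R1 \<union> ?R2"
        using u by (cases "x = Suc k") (force simp: xv decreasing_words_def)+
    next
      fix u assume "u \<in> ?R1 \<union> ?R2"
      then show "u \<in> ?L"
        by (force simp: decreasing_words_def)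
    qed
    have "card ?L = card ?R1 + card ?R2"
      unfolding split
      by (rule card_Un_disjoint) (simp_all add: finite_decreasing_words, auto simp: decreasing_words_def)
    then show ?thesis
      by (simp add: Suc Suc.IH card_image)
  qed
qed

lemma plateau_words_image:
  "plateau_words k r =
     (\<lambda>(j, u). replicate (r - j) (Suc k) @ u) ` (SIGMA j:{..r}. decreasing_words k j)"
proof (intro set_eqI iffI)
  fix v assume "v \<in> plateau_words k r"
  then obtain i u where "v = replicate i (Suc k) @ u" "i + length u = r"
      "u \<in> decreasing_words k (length u)"
    by (auto simp: plateau_words_def)
  then have "v = (\<lambda>(j, u). replicate (r - j) (Suc k) @ u) (length u, u)"
      "(length u, u) \<in> (SIGMA j:{..r}. decreasing_words k j)"
    by auto
  then show "v \<in> (\<lambda>(j, u). replicate (r - j) (Suc k) @ u) `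
      (SIGMA j:{..r}. decreasing_words k j)"
    by (rule image_eqI)
qed (force simp: plateau_words_def decreasing_words_def)

lemma finite_plateau_words: "finite (plateau_words k r)"
  unfolding plateau_words_image by (auto simp: finite_decreasing_words)

lemma card_plateau_words: "card (plateau_words k r) = (\<Sum>j<Suc r. k choose j)"
proof -
  \<comment> \<open>The decreasing part is recovered by deleting the letters \<open>k + 1\<close>.\<close>
  have "inj_on (\<lambda>(j, u). replicate (r - j) (Suc k) @ u) (SIGMA j:{..r}. decreasing_words k j)"
  proof (rule inj_on_inverseI)
    fix z assume "z \<in> (SIGMA j:{..r}. decreasing_words k j)"
    then obtain j u where z: "z = (j, u)" and u: "length u = j" "set u \<subseteq> {1..k}"
      by (auto simp: decreasing_words_def)
    then have "filter (\<lambda>x. x \<le> k) u = u"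
      by (auto simp: filter_id_conv)
    with z u show "(\<lambda>w. (length (filter (\<lambda>x. x \<le> k) w), filter (\<lambda>x. x \<le> k) w))
        ((\<lambda>(j, u). replicate (r - j) (Suc k) @ u) z) = z"
      by simp
  qed
  then show ?thesis
    unfolding plateau_words_image
    by (simp add: card_image card_decreasing_words finite_decreasing_words lessThan_Suc_atMost)
qed

text \<open>
  Inserting a single \<open>0\<close> into a word of length \<open>l\<close> without zeros can be done in \<open>l + 1\<close> places,
  and both the word and the place can be recovered from the result.
\<close>

lemma card_one_zero_words:
  assumes "finite A" "\<And>v. v \<in> A \<Longrightarrow> length v = l \<and> 0 \<notin> set v"
  shows "finite {w. count_list w (0::nat) = 1 \<and> filter (\<lambda>x. x \<noteq> 0) w \<in> A}" (is "finite ?W")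
    and "card {w. count_list w (0::nat) = 1 \<and> filter (\<lambda>x. x \<noteq> 0) w \<in> A} = Suc l * card A"
proof -
  let ?f = "\<lambda>(i, v). take i v @ 0 # drop i v"
  have no0: "filter (\<lambda>x. x \<noteq> 0) v = v" if "0 \<notin> set v" for v :: "nat list"
    using that by (auto simp: filter_id_conv intro!: gr0I)
  have eq: "?W = ?f ` ({..l} \<times> A)"
  proof (intro set_eqI iffI)
    fix w assume w: "w \<in> ?W"
    then have "0 \<in> set w" using count_list_0_iff[of w 0] by auto
    then obtain u v where uv: "w = u @ 0 # v" by (auto simp: in_set_conv_decomp)
    with w have "count_list u 0 = 0" "count_list v 0 = 0" by auto
    then have "0 \<notin> set u" "0 \<notin> set v" by (auto simp: count_list_0_iff)
    then have "filter (\<lambda>x. x \<noteq> 0) w = u @ v" unfolding uv using no0[of u] no0[of v] by simp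
    with w have "u @ v \<in> A" by simp
    moreover from assms(2)[OF this] have "length u \<le> l" by auto
    ultimately have "(length u, u @ v) \<in> {..l} \<times> A" by auto
    moreover have "w = ?f (length u, u @ v)" using uv by simp
    ultimately show "w \<in> ?f ` ({..l} \<times> A)" by (rule rev_image_eqI)
  next
    fix w assume "w \<in> ?f ` ({..l} \<times> A)"
    then obtain i v where w: "w = take i v @ 0 # drop i v" and v: "v \<in> A" by auto
    have "count_list (take i v) 0 + count_list (drop i v) 0 = count_list v 0"
      by (metis append_take_drop_id count_list_append)
    moreover have "count_list v 0 = 0" using assms(2)[OF v] by simp
    moreover have "filter (\<lambda>x. x \<noteq> 0) w = v"
      using no0[of v] assms(2)[OF v]
      by (metis (mono_tags, lifting) append_take_drop_id filter.simps(2) filter_append w)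
    ultimately show "w \<in> ?W" using v by (simp add: w)
  qed
  have inj: "inj_on ?f ({..l} \<times> A)"
  proof (rule inj_on_inverseI)
    fix z assume "z \<in> {..l} \<times> A"
    then obtain i v where z: "z = (i, v)" "i \<le> l" "v \<in> A" by auto
    have v: "length v = l" "0 \<notin> set v" using assms(2) z by auto
    have "filter (\<lambda>x. x \<noteq> 0) (?f z) = filter (\<lambda>x. x \<noteq> 0) (take i v @ drop i v)"
      by (simp add: z del: append_take_drop_id)
    also have "\<dots> = v" using no0[OF v(2)] by simp
    finally have f: "filter (\<lambda>x. x \<noteq> 0) (?f z) = v" .
    have "\<forall>x\<in>set (take i v). x \<noteq> 0" using v(2) by (metis in_set_takeD)
    then have "takeWhile (\<lambda>x. x \<noteq> 0) (?f z) = take i v"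
      by (simp add: z takeWhile_append2)
    with f z v show "(\<lambda>w. (length (takeWhile (\<lambda>x. x \<noteq> 0) w), filter (\<lambda>x. x \<noteq> 0) w)) (?f z) = z"
      by simp
  qed
  show "finite ?W" unfolding eq using assms(1) by simp
  show "card ?W = Suc l * card A" unfolding eq by (simp add: card_image[OF inj] card_cartesian_product)
qed

lemma length_filter_nonzero:
  "length (filter (\<lambda>x. x \<noteq> 0) w) + count_list w (0::nat) = length w"
  by (induction w) auto

lemma
  shows finite_tails: "finite (tails k r)"
    and card_tails: "card (tails k r) = (\<Sum>j<Suc r. k choose j) + r * (\<Sum>j<r. k choose j)"
proof -
  let ?pos = "filter (\<lambda>x. x \<noteq> (0::nat))"
  let ?Z = "{w. count_list w 0 = 1 \<and> length w = r \<and> ?pos w \<in> plateau_words k (r - 1)}"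
  have len: "length v = s \<and> 0 \<notin> set v" if "v \<in> plateau_words k s" for v s
    using that plateau_words_bounds[OF that] by (auto simp: plateau_words_def)
  have split: "tails k r = plateau_words k r \<union> ?Z"
  proof (intro set_eqI iffI)
    fix w assume w: "w \<in> tails k r"
    then consider "count_list w 0 = 0" | "count_list w 0 = 1" by (force simp: tails_def)
    then show "w \<in> plateau_words k r \<union> ?Z"
    proof cases
      case 1
      then have "?pos w = w" by (auto simp: count_list_0_iff filter_id_conv intro!: gr0I)
      with w show ?thesis by (auto simp: tails_def)
    next
      case 2
      with w length_filter_nonzero[of w] have "length (?pos w) = r - 1" by (simp add: tails_def)
      with w 2 show ?thesis by (simp add: tails_def)
    qed
  next
    fix w assume "w \<in> plateau_words k r \<union> ?Z"
    then show "w \<in> tails k r"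
    proof
      assume w: "w \<in> plateau_words k r"
      with len[OF w] have "?pos w = w" by (auto simp: filter_id_conv intro!: gr0I)
      with w len[OF w] show ?thesis by (simp add: tails_def)
    next
      assume w: "w \<in> ?Z"
      with len[of "?pos w" "r - 1"] show ?thesis by (simp add: tails_def)
    qed
  qed
  have Z: "finite ?Z \<and> card ?Z = r * (\<Sum>j<r. k choose j)"
  proof (cases r)
    case 0
    have "?Z = {}" by (auto simp: 0)
    then show ?thesis by (simp only: 0) simp
  next
    case (Suc l)
    have "?Z = {w. count_list w 0 = 1 \<and> ?pos w \<in> plateau_words k l}"
    proof (intro Collect_cong)
      fix w
      show "(count_list w 0 = 1 \<and> length w = r \<and> ?pos w \<in> plateau_words k (r - 1)) \<longleftrightarrow>
          (count_list w 0 = 1 \<and> ?pos w \<in> plateau_words k l)"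
        using len[of "?pos w" l] length_filter_nonzero[of w] Suc by auto
    qed
    then show ?thesis
      using card_one_zero_words[OF finite_plateau_words[of k l] len] Suc
      by (simp add: card_plateau_words)
  qed
  have "w \<notin> ?Z" if "w \<in> plateau_words k r" for w
    using len[OF that] count_list_0_iff[of w 0] by simp
  then have disj: "plateau_words k r \<inter> ?Z = {}" by blast
  show "finite (tails k r)" unfolding split using Z finite_plateau_words by simp
  show "card (tails k r) = (\<Sum>j<Suc r. k choose j) + r * (\<Sum>j<r. k choose j)"
    unfolding split using Z card_Un_disjoint[OF finite_plateau_words _ disj]
    by (simp only: card_plateau_words)
qed

section \<open>Avoiders are characterised by their tails\<close>

lemma decreasing_not_repeated:
  "u \<in> decreasing_words k r \<Longrightarrow> \<not> subseq [a, a] u"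
  by (auto simp: decreasing_words_def sorted_wrt_iff_subseq)

lemma plateau_wordsD:
  assumes "v \<in> plateau_words k r"
  shows "sorted_wrt (\<ge>) (Suc k # v)" and "a < b \<Longrightarrow> \<not> subseq [b, a, a] (Suc k # v)"
proof -
  obtain i u where v: "v = replicate i (Suc k) @ u" and u: "u \<in> decreasing_words k (length u)"
    using assms by (auto simp: plateau_words_def)
  have u': "sorted_wrt (>) u" "set u \<subseteq> {1..k}" using u by (auto simp: decreasing_words_def)
  have "sorted_wrt (\<ge>) u"
    by (rule sorted_wrt_mono_rel[OF _ u'(1)]) auto
  then have "sorted_wrt (\<ge>) (replicate j (Suc k) @ u)" for j
    using u'(2) by (induction j) auto
  from this[of "Suc i"] show "sorted_wrt (\<ge>) (Suc k # v)"
    by (simp add: v)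
  assume ab: "a < b"
  show "\<not> subseq [b, a, a] (Suc k # v)"
  proof
    assume s: "subseq [b, a, a] (Suc k # v)"
    then have "b \<in> set (Suc k # v)"
      using subseq_set by fastforce
    then have "a \<noteq> Suc k" using u'(2) ab by (auto simp: v)
    have "subseq [a, a] (Suc k # v)" using s by (rule subseq_Cons')
    then have "subseq [a, a] (replicate (Suc i) (Suc k) @ u)"
      by (simp only: v replicate_Suc append_Cons)
    with \<open>a \<noteq> Suc k\<close> have "subseq [a, a] u"
      using subseq_replicate_append_neq[of a "Suc k" "[a]" "Suc i" u] by blast
    with u show False by (simp add: decreasing_not_repeated)
  qed
qed

text \<open>
  The converse: as \<open>v\<close> is weakly decreasing, a repetition of a letter below \<open>k + 1\<close> would give,
  together with the leading \<open>k + 1\<close>, an occurrence of \<open>100\<close>.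
\<close>

lemma plateau_wordsI:
  assumes "\<forall>x\<in>set v. 0 < x" "sorted_wrt (\<ge>) (Suc k # v)"
    "\<forall>a b. a < b \<longrightarrow> \<not> subseq [b, a, a] (Suc k # v)"
  shows "v \<in> plateau_words k (length v)"
  using assms
proof (induction v)
  case Nil
  then show ?case by (auto simp: plateau_words_def decreasing_words_def)
next
  case (Cons x v)
  show ?case
  proof (cases "x = Suc k")
    case True
    have "v \<in> plateau_words k (length v)"
    proof (rule Cons.IH)
      show "\<forall>a b. a < b \<longrightarrow> \<not> subseq [b, a, a] (Suc k # v)"
        using Cons.prems(3) True by (metis list_emb_Cons)
    qed (use Cons.prems True in auto)
    then obtain i u where "v = replicate i (Suc k) @ u" "u \<in> decreasing_words k (length u)"
      by (auto simp: plateau_words_def)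
    then have "x # v = replicate (Suc i) (Suc k) @ u \<and> Suc i + length u = length (x # v)"
      using True by simp
    then show ?thesis
      using \<open>u \<in> _\<close> unfolding plateau_words_def by blast
  next
    case False
    then have less: "y < Suc k" if "y \<in> set (x # v)" for y
      using Cons.prems(2) that by auto
    have "a > b" if ab: "subseq [a, b] (x # v)" for a b
    proof -
      have "subseq [a, b] (Suc k # x # v)" using ab by (rule list_emb_Cons)
      with Cons.prems(2) have "a \<ge> b" unfolding sorted_wrt_iff_subseq by blast
      moreover have "a \<noteq> b"
      proof
        assume "a = b"
        moreover have "a \<in> set (x # v)" using ab using subseq_set by fastforce
        ultimately show False
          using Cons.prems(3) less[of a] ab by (metis subseq_Cons2)
      qed
      ultimately show ?thesis by simp
    qed
    then have "sorted_wrt (>) (x # v)" by (simp only: sorted_wrt_iff_subseq) blast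
    moreover have "set (x # v) \<subseteq> {1..k}"
      using Cons.prems(1) less by (fastforce simp: Suc_le_eq)
    ultimately have "x # v \<in> decreasing_words k (length (x # v))"
      by (simp only: decreasing_words_def) simp
    then have "x # v = replicate 0 (Suc k) @ (x # v) \<and> 0 + length (x # v) = length (x # v)
        \<and> x # v \<in> decreasing_words k (length (x # v))" by simp
    then show ?thesis unfolding plateau_words_def by blast
  qed
qed

text \<open>
  A positive ascent combines with a leading zero into \<open>012\<close>, so avoiding \<open>012\<close> means that the
  positive letters weakly decrease. Avoiding \<open>100\<close> splits according to the repeated letter: for
  \<open>0\<close> it says that \<open>w\<close> has at most one zero, and for a positive letter it only concerns the
  subsequence of positive letters.
\<close>

lemma avoids_iff_mem_tails:
  assumes "0 < p"
  shows "(\<not> contains_pattern (replicate p 0 @ Suc k # w) [0,1,2] \<and>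
          \<not> contains_pattern (replicate p 0 @ Suc k # w) [1,0,0])
        \<longleftrightarrow> w \<in> tails k (length w)"
proof -
  let ?pos = "filter (\<lambda>x. x \<noteq> (0::nat))"
  let ?e = "replicate p 0 @ Suc k # w"
  have pos_e: "?pos ?e = Suc k # ?pos w" by simp
  have c012: "\<not> contains_pattern ?e [0,1,2] \<longleftrightarrow> sorted_wrt (\<ge>) (Suc k # ?pos w)"
  proof
    assume av: "\<not> contains_pattern ?e [0,1,2]"
    have "b \<ge> c" if bc: "subseq [b, c] (?pos ?e)" for b c
    proof (rule ccontr)
      assume "\<not> b \<ge> c"
      have "set [b, c] \<subseteq> set (?pos ?e)" using bc by (rule subseq_set)
      then have "0 < b" "0 < c" by auto
      have "subseq [b, c] ?e" using bc by (meson subseq_filter_left subseq_order.order_trans)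
      then have "subseq [b, c] (replicate (p - 1) 0 @ Suc k # w)"
        using \<open>0 < b\<close> by (simp add: subseq_replicate_append_neq)
      then have "subseq [0, b, c] (0 # replicate (p - 1) 0 @ Suc k # w)" by simp
      moreover have "0 # replicate (p - 1) 0 = replicate p 0"
        using assms by (metis Suc_pred' replicate_Suc)
      ultimately have "subseq [0, b, c] ?e" by (metis append_Cons)
      moreover have "b < c" using \<open>\<not> b \<ge> c\<close> by simp
      ultimately show False using av \<open>0 < b\<close> unfolding contains_012_iff by blast
    qed
    then show "sorted_wrt (\<ge>) (Suc k # ?pos w)"
      by (simp only: pos_e sorted_wrt_iff_subseq) blast
  next
    assume srt: "sorted_wrt (\<ge>) (Suc k # ?pos w)"
    show "\<not> contains_pattern ?e [0,1,2]"
    proof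
      assume "contains_pattern ?e [0,1,2]"
      then obtain a b c where abc: "subseq [a,b,c] ?e" "a < b" "b < c"
        unfolding contains_012_iff by blast
      then have "subseq [b, c] (?pos ?e)"
        using subseq_filter_iff[of "[b, c]" "\<lambda>x. x \<noteq> 0" ?e] subseq_Cons'[OF abc(1)] by auto
      with srt abc(3) show False by (simp only: pos_e sorted_wrt_iff_subseq) force
    qed
  qed
  have c100: "\<not> contains_pattern ?e [1,0,0] \<longleftrightarrow>
      count_list w 0 \<le> 1 \<and> (\<forall>a b. a < b \<longrightarrow> \<not> subseq [b, a, a] (Suc k # ?pos w))"
  proof -
    have zero: "(\<exists>b>0. subseq [b, 0, 0] ?e) \<longleftrightarrow> 2 \<le> count_list w 0"
    proof
      assume "\<exists>b>0. subseq [b, 0, 0] ?e"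
      then obtain b where "0 < b" "subseq [b, 0, 0] ?e" by blast
      then have "subseq [b, 0, 0] (Suc k # w)" by (simp add: subseq_replicate_append_neq)
      then have "subseq [0, 0] (Suc k # w)" by (rule subseq_Cons')
      then show "2 \<le> count_list w 0" by (simp add: subseq_same_two_iff)
    next
      assume "2 \<le> count_list w 0"
      then have "subseq [Suc k, 0, 0] (Suc k # w)" by (simp add: subseq_same_two_iff)
      then have "subseq [Suc k, 0, 0] ?e" by (rule subseq_drop_many)
      then show "\<exists>b>0. subseq [b, 0, 0] ?e" by blast
    qed
    have nonzero: "subseq [b, a, a] ?e \<longleftrightarrow> subseq [b, a, a] (Suc k # ?pos w)"
      if "0 < a" "a < b" for a b
      using subseq_filter_iff[of "[b, a, a]" "\<lambda>x. x \<noteq> 0" ?e] that by (simp only: pos_e) simp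
    have pos: "0 < a" if "subseq [b, a, a] (Suc k # ?pos w)" for a b
      using subseq_set[OF that] by auto
    have ex_split: "(\<exists>a b. Q a b \<and> a < b) \<longleftrightarrow> (\<exists>b>0. Q 0 b) \<or> (\<exists>a b. 0 < a \<and> a < b \<and> Q a b)"
      for Q :: "nat \<Rightarrow> nat \<Rightarrow> bool"
      by (metis gr0I)
    have "contains_pattern ?e [1,0,0] \<longleftrightarrow>
        (\<exists>b>0. subseq [b, 0, 0] ?e) \<or> (\<exists>a b. 0 < a \<and> a < b \<and> subseq [b, a, a] ?e)"
      unfolding contains_100_iff by (rule ex_split[of "\<lambda>a b. subseq [b, a, a] ?e"])
    also have "(\<lambda>a b. 0 < a \<and> a < b \<and> subseq [b, a, a] ?e) =
        (\<lambda>a b. a < b \<and> subseq [b, a, a] (Suc k # ?pos w))"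
      using nonzero pos by (intro ext) metis
    finally show ?thesis unfolding zero by (auto simp: not_le)
  qed
  have "?pos w \<in> plateau_words k (length (?pos w)) \<longleftrightarrow>
      sorted_wrt (\<ge>) (Suc k # ?pos w) \<and> (\<forall>a b. a < b \<longrightarrow> \<not> subseq [b, a, a] (Suc k # ?pos w))"
  proof
    assume "?pos w \<in> plateau_words k (length (?pos w))"
    from plateau_wordsD[OF this]
    show "sorted_wrt (\<ge>) (Suc k # ?pos w) \<and>
        (\<forall>a b. a < b \<longrightarrow> \<not> subseq [b, a, a] (Suc k # ?pos w))"
      by blast
  next
    assume h: "sorted_wrt (\<ge>) (Suc k # ?pos w) \<and>
        (\<forall>a b. a < b \<longrightarrow> \<not> subseq [b, a, a] (Suc k # ?pos w))"
    show "?pos w \<in> plateau_words k (length (?pos w))"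
      by (rule plateau_wordsI) (use h in simp_all)
  qed
  then show ?thesis
    unfolding c012 c100 tails_def mem_Collect_eq by blast
qed

lemma zero_or_first_positive:
  fixes e :: "nat list"
  obtains "e = replicate (length e) 0"
  | p k w where "e = replicate p 0 @ Suc k # w"
proof (cases "dropWhile (\<lambda>x. x = 0) e")
  case Nil
  then have "e = replicate (length e) 0"
    by (metis (mono_tags, lifting) dropWhile_eq_Nil_conv replicate_eqI)
  then show ?thesis by (rule that)
next
  case (Cons m w)
  then have "m \<noteq> 0" using hd_dropWhile[of "\<lambda>x. x = 0" e] by simp
  then obtain k where k: "m = Suc k" by (cases m) auto
  have "takeWhile (\<lambda>x. x = 0) e = replicate (length (takeWhile (\<lambda>x. x = 0) e)) 0"
    by (rule replicate_eqI) (auto dest: set_takeWhileD)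
  then obtain p where "takeWhile (\<lambda>x. x = 0) e = replicate p 0" by blast
  then have "e = replicate p 0 @ Suc k # w"
    using takeWhile_dropWhile_id[of "\<lambda>x. x = 0" e] Cons k by simp
  then show ?thesis by (rule that)
qed

text \<open>Since no letter exceeds the first positive one, only that letter restricts membership.\<close>

lemma inv_seqs_replicate_append_iff:
  assumes "\<forall>x\<in>set w. x \<le> Suc k"
  shows "replicate p 0 @ Suc k # w \<in> inv_seqs n \<longleftrightarrow> p + length w = n \<and> k < p"
proof
  assume e: "replicate p 0 @ Suc k # w \<in> inv_seqs n"
  then have n: "p + length w = n" by (simp add: inv_seqs_def)
  with e have "(replicate p 0 @ Suc k # w) ! p \<le> p" unfolding inv_seqs_def by auto
  with n show "p + length w = n \<and> k < p" by (simp add: nth_append)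
next
  assume n: "p + length w = n \<and> k < p"
  have "(replicate p 0 @ Suc k # w) ! i \<le> i" if "i \<le> n" for i
  proof (cases "i < p")
    case True
    then show ?thesis by (simp add: nth_append)
  next
    case False
    with that n have "(Suc k # w) ! (i - p) \<in> set (Suc k # w)" by (intro nth_mem) auto
    with assms have "(Suc k # w) ! (i - p) \<le> Suc k" by auto
    with False n show ?thesis by (simp add: nth_append)
  qed
  with n show "replicate p 0 @ Suc k # w \<in> inv_seqs n" by (simp add: inv_seqs_def)
qed

lemma tails_le: "w \<in> tails k r \<Longrightarrow> \<forall>x\<in>set w. x \<le> Suc k"
proof
  fix x assume "w \<in> tails k r" "x \<in> set w"
  then show "x \<le> Suc k"
    using plateau_words_bounds[of "filter (\<lambda>x. x \<noteq> 0) w" k "length (filter (\<lambda>x. x \<noteq> 0) w)"]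
    by (cases "x = 0") (auto simp: tails_def)
qed

text \<open>
  The index \<open>p\<close> counts the leading zeros and \<open>k + 1\<close> is the first positive letter. For \<open>p = 0\<close>
  there is no admissible \<open>k\<close>, so no lower bound on \<open>p\<close> is needed.
\<close>

lemma inv_seqs_avoiding_decomposition:
  "inv_seqs_avoiding n {[1,0,0], [0,1,2]} =
     insert (replicate (Suc n) 0)
       ((\<lambda>(p, k, w). replicate p 0 @ Suc k # w) `
          (SIGMA p:{..n}. SIGMA k:{..<p}. tails k (n - p)))" (is "?L = insert ?z (?f ` ?S)")
proof (intro set_eqI iffI)
  fix e assume e: "e \<in> ?L"
  then have len: "length e = Suc n" and inv: "e \<in> inv_seqs n"
    by (auto simp: inv_seqs_avoiding_def inv_seqs_def)
  show "e \<in> insert ?z (?f ` ?S)"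
  proof (cases e rule: zero_or_first_positive)
    case 1
    with len show ?thesis by simp
  next
    case (2 p k w)
    have "e ! 0 = 0" using inv by (auto simp: inv_seqs_def)
    with 2 have p: "0 < p" by (cases p) auto
    have "w \<in> tails k (length w)"
      using e unfolding avoids_iff_mem_tails[OF p, symmetric] 2[symmetric]
      by (simp add: inv_seqs_avoiding_def)
    moreover from tails_le[OF this] have "p + length w = n \<and> k < p"
      using inv unfolding 2 by (simp only: inv_seqs_replicate_append_iff)
    ultimately have "(p, k, w) \<in> ?S" by auto
    moreover have "e = ?f (p, k, w)" using 2 by simp
    ultimately show ?thesis by blast
  qed
next
  fix e assume "e \<in> insert ?z (?f ` ?S)"
  then consider "e = ?z" | p k w where "e = replicate p 0 @ Suc k # w" "p \<le> n" "k < p"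
      "w \<in> tails k (n - p)"
    by auto
  then show "e \<in> ?L"
  proof cases
    case 1
    have zero: "x = 0" if "subseq s ?z" "x \<in> set s" for s x
      using list_emb_set[OF that] by auto
    have "\<not> contains_pattern ?z [0,1,2]"
    proof
      assume "contains_pattern ?z [0,1,2]"
      then obtain a b c where "subseq [a, b, c] ?z" "a < b" unfolding contains_012_iff by blast
      then show False using zero[of "[a, b, c]" b] by simp
    qed
    moreover have "\<not> contains_pattern ?z [1,0,0]"
    proof
      assume "contains_pattern ?z [1,0,0]"
      then obtain a b where "subseq [b, a, a] ?z" "a < b" unfolding contains_100_iff by blast
      then show False using zero[of "[b, a, a]" b] by simp
    qed
    moreover have "?z \<in> inv_seqs n" by (simp add: inv_seqs_def less_Suc_eq_le del: replicate_Suc)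
    ultimately show ?thesis using 1 by (simp add: inv_seqs_avoiding_def)
  next
    case 2
    then have w: "w \<in> tails k (length w)" "p + length w = n" by (auto simp: tails_def)
    with 2 show ?thesis
      using avoids_iff_mem_tails[of p k w] inv_seqs_replicate_append_iff[OF tails_le[OF w(1)], of p n]
      by (simp add: inv_seqs_avoiding_def)
  qed
qed

lemma card_inv_seqs_avoiding:
  "card (inv_seqs_avoiding n {[1,0,0], [0,1,2]}) =
     1 + (\<Sum>p\<le>n. (\<Sum>j<Suc (n - p). p choose Suc j) + (n - p) * (\<Sum>j<n - p. p choose Suc j))"
proof -
  let ?f = "\<lambda>(p, k, w). replicate p (0::nat) @ Suc k # w"
  let ?S = "SIGMA p:{..n}. SIGMA k:{..<p}. tails k (n - p)"
  have "inj_on ?f ?S"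
  proof (rule inj_on_inverseI)
    fix z :: "nat \<times> nat \<times> nat list"
    obtain p k w where z: "z = (p, k, w)" by (rule prod_cases3)
    have "takeWhile (\<lambda>x. x = 0) (replicate p 0 @ Suc k # w) = replicate p 0"
         "dropWhile (\<lambda>x. x = 0) (replicate p 0 @ Suc k # w) = Suc k # w" for p
      by (induction p) auto
    with z show "(\<lambda>e. (length (takeWhile (\<lambda>x. x = 0) e),
        hd (dropWhile (\<lambda>x. x = 0) e) - 1, tl (dropWhile (\<lambda>x. x = 0) e))) (?f z) = z"
      by simp
  qed
  then have "card (?f ` ?S) = (\<Sum>p\<le>n. \<Sum>k<p. card (tails k (n - p)))"
    by (simp add: card_image finite_tails)
  moreover have "replicate (Suc n) 0 \<notin> ?f ` ?S"
  proof
    assume "replicate (Suc n) 0 \<in> ?f ` ?S"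
    then obtain p k w where "replicate (Suc n) 0 = replicate p 0 @ Suc k # w" by auto
    then have "Suc k \<in> set (replicate (Suc n) 0)" by simp
    then show False by simp
  qed
  moreover have "finite (?f ` ?S)" by (simp add: finite_tails)
  \<comment> \<open>Hockey stick identity, summing over the first positive letter.\<close>
  moreover have "(\<Sum>k<p. \<Sum>j<q. k choose j) = (\<Sum>j<q. p choose Suc j)" for p q
  proof -
    have "(\<Sum>k<p. k choose j) = p choose Suc j" for j
      by (cases p) (simp_all add: sum_choose_upper lessThan_Suc_atMost)
    then show ?thesis by (subst sum.swap) simp
  qed
  ultimately show ?thesis
    unfolding inv_seqs_avoiding_decomposition
    by (simp add: card_tails sum.distrib
        flip: sum_distrib_left del: sum.lessThan_Suc)
qed

section \<open>Diagonal sums of binomial coefficients\<close>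

lemma fib_Suc_diagonal: "(\<Sum>p\<le>n. p choose (n - p)) = fib (Suc n)"
proof -
  have "(\<Sum>p\<le>n. p choose (n - p)) = (\<Sum>k = 0..n. (n - k) choose k)"
    by (subst sum.atLeastAtMost_rev) (auto simp: atMost_atLeast0 intro!: sum.cong)
  then show ?thesis by (simp only: ne_diagonal_fib)
qed

text \<open>
  By Pascal's rule the weighted diagonal sums \<open>W\<close> satisfy \<open>W (n + 2) = W (n + 1) + W n + fib (n + 1)\<close>.
  The closed form is stated without subtraction.
\<close>

lemma weighted_diagonal:
  "5 * (\<Sum>p\<le>n. (n - p) * (p choose (n - p))) + (n + 1) * fib n = 2 * n * fib (Suc n)"
proof -
  define W where "W n = (\<Sum>p\<le>n. (n - p) * (p choose (n - p)))" for n
  have rec: "W (Suc (Suc n)) = W (Suc n) + W n + fib (Suc n)" for n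
  proof -
    have "W (Suc (Suc n)) = (\<Sum>p\<le>n. (Suc n - p) * (Suc p choose (Suc n - p)))"
      by (simp add: W_def sum.atMost_Suc_shift[of _ "Suc n"] del: sum.atMost_Suc binomial_Suc_Suc) simp
    also have "\<dots> = (\<Sum>p\<le>n. (Suc n - p) * (p choose (Suc n - p)) + (n - p) * (p choose (n - p))
        + (p choose (n - p)))"
      by (rule sum.cong) (auto simp: Suc_diff_le add_mult_distrib2)
    also have "\<dots> = W (Suc n) + W n + fib (Suc n)"
      by (simp add: sum.distrib W_def fib_Suc_diagonal)
    finally show ?thesis .
  qed
  have "5 * W n + (n + 1) * fib n = 2 * n * fib (Suc n)"
  proof (induction n rule: fib.induct)
    case 1
    then show ?case by (simp add: W_def)
  next
    case 2
    then show ?case by (simp add: W_def)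
  next
    case (3 n)
    have "int (5 * W (Suc (Suc n)) + (Suc (Suc n) + 1) * fib (Suc (Suc n))) =
        int (2 * Suc (Suc n) * fib (Suc (Suc (Suc n))))"
      using 3[THEN arg_cong[of _ _ int]] by (simp add: rec algebra_simps)
    then show ?case by (simp only: of_nat_eq_iff)
  qed
  then show ?thesis by (simp only: W_def)
qed

lemma sum_partial_binomials:
  "(\<Sum>p\<le>n. \<Sum>j<Suc (n - p). p choose Suc j) + n + 3 = fib (n + 4)"
proof (induction n)
  case 0
  then show ?case by (simp add: numeral_eq_Suc)
next
  case (Suc n)
  have "(\<Sum>p\<le>Suc n. \<Sum>j<Suc (Suc n - p). p choose Suc j) =
      (\<Sum>p\<le>n. \<Sum>j<Suc (Suc n - p). p choose Suc j) + Suc n"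
    by simp
  also have "(\<Sum>p\<le>n. \<Sum>j<Suc (Suc n - p). p choose Suc j) =
      (\<Sum>p\<le>n. (\<Sum>j<Suc (n - p). p choose Suc j) + (p choose (Suc (Suc n) - p)))"
    by (rule sum.cong) (auto simp: Suc_diff_le)
  also have "\<dots> = (\<Sum>p\<le>n. \<Sum>j<Suc (n - p). p choose Suc j) +
      (\<Sum>p\<le>n. p choose (Suc (Suc n) - p))"
    by (rule sum.distrib)
  finally show ?case
    using Suc fib_Suc_diagonal[of "Suc (Suc n)"] by (simp add: numeral_eq_Suc)
qed

text \<open>
  Passing from \<open>n\<close> to \<open>n + 1\<close> adds one binomial coefficient, lying on a diagonal, to each inner
  sum and raises its weight by one. The Fibonacci number on the left avoids a subtraction.
\<close>

lemma sum_weighted_partial_binomials_Suc: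
  "(\<Sum>p\<le>Suc n. (Suc n - p) * (\<Sum>j<Suc n - p. p choose Suc j)) + fib (n + 2) =
     (\<Sum>p\<le>n. (n - p) * (\<Sum>j<n - p. p choose Suc j)) +
     (\<Sum>p\<le>n. \<Sum>j<Suc (n - p). p choose Suc j) +
     (\<Sum>p\<le>Suc n. (Suc n - p) * (p choose (Suc n - p))) + 1"
proof -
  have "(\<Sum>p\<le>n. (Suc n - p) * (\<Sum>j<Suc n - p. p choose Suc j) + (p choose (Suc n - p))) =
      (\<Sum>p\<le>n. (n - p) * (\<Sum>j<n - p. p choose Suc j) + (\<Sum>j<Suc (n - p). p choose Suc j)
         + (Suc n - p) * (p choose (Suc n - p)))"
    by (rule sum.cong) (auto simp: Suc_diff_le algebra_simps)
  then show ?thesis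
    using fib_Suc_diagonal[of "Suc n"] by (simp add: sum.distrib del: sum.lessThan_Suc)
qed

lemma sum_weighted_partial_binomials:
  "10 * (of_nat (\<Sum>p\<le>n. (n - p) * (\<Sum>j<n - p. p choose Suc j)) :: rat) =
     2 * ((of_nat n + 8) * of_nat (fib (n + 1)) + 15 * of_nat (fib (n + 2))
          + (of_nat n + 1) * of_nat (fib (n + 3)) - 5 * of_nat (fib (n + 4)))
     + 10 * of_nat n + 10 - 5 * (of_nat n + 3) * (of_nat n + 2)"
proof (induction n)
  case 0
  then show ?case by (simp add: numeral_eq_Suc)
next
  case (Suc n)
  let ?r = "of_nat :: nat \<Rightarrow> rat"
  define V where "V n = ?r (\<Sum>p\<le>n. (n - p) * (\<Sum>j<n - p. p choose Suc j))" for n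
  define U where "U = ?r (\<Sum>p\<le>n. \<Sum>j<Suc (n - p). p choose Suc j)"
  define W where "W = ?r (\<Sum>p\<le>Suc n. (Suc n - p) * (p choose (Suc n - p)))"
  have V: "V (Suc n) + ?r (fib (n + 2)) = V n + U + W + 1"
    using sum_weighted_partial_binomials_Suc[of n, THEN arg_cong[of _ _ ?r]]
    unfolding V_def U_def W_def by (simp only: of_nat_add of_nat_1)
  have U: "U + ?r n + 3 = ?r (fib (n + 4))"
    using sum_partial_binomials[of n, THEN arg_cong[of _ _ ?r]]
    unfolding U_def by (simp only: of_nat_add of_nat_numeral)
  have W: "5 * W + (?r n + 2) * ?r (fib (n + 1)) = 2 * (?r n + 1) * ?r (fib (n + 2))"
    using weighted_diagonal[of "Suc n", THEN arg_cong[of _ _ ?r]]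
    unfolding of_nat_add of_nat_mult of_nat_numeral W_def[symmetric] by (simp add: algebra_simps)
  have f: "fib (n + 2) = fib n + fib (n + 1)" "fib (n + 3) = fib n + 2 * fib (n + 1)"
      "fib (n + 4) = 2 * fib n + 3 * fib (n + 1)" "fib (n + 5) = 3 * fib n + 5 * fib (n + 1)"
    by (simp_all add: numeral_eq_Suc)
  have s: "Suc n + 1 = n + 2" "Suc n + 2 = n + 3" "Suc n + 3 = n + 4" "Suc n + 4 = n + 5" by simp_all
  show ?case
    using Suc V U W unfolding V_def[symmetric] s f of_nat_add of_nat_mult
    by (simp add: algebra_simps)
qed

section \<open>The generating function\<close>

lemma of_nat_choose_two: "(of_nat (n choose 2) :: rat) = of_nat n * (of_nat n - 1) / 2"
  by (induction n) (simp_all add: numeral_2_eq_2 field_simps)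

lemma denominator_expand:
  fixes x :: "'a :: comm_ring_1"
  shows "(1 - x) ^ 3 * (1 - x - x ^ 2) ^ 2 =
    1 - 5 * x ^ 1 + 8 * x ^ 2 - 2 * x ^ 3 - 6 * x ^ 4 + 4 * x ^ 5 + x ^ 6 - x ^ 7"
  by (simp add: eval_nat_numeral algebra_simps)

lemma numerator_expand:
  fixes x :: "'a :: comm_ring_1"
  shows "x * (x ^ 6 - x ^ 5 - 3 * x ^ 4 + x ^ 3 + 3 * x ^ 2 - 3 * x + 1) =
    x ^ 7 - x ^ 6 - 3 * x ^ 5 + x ^ 4 + 3 * x ^ 3 - 3 * x ^ 2 + x ^ 1"
  by (simp add: eval_nat_numeral algebra_simps)

text \<open>
  The roots of the denominator match the shape of the closed form: \<open>(1 - x)^3\<close> accounts for the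
  quadratic polynomial and \<open>(1 - x - x^2)^2\<close> for the Fibonacci numbers with linear coefficients.
  Extended to index \<open>0\<close> of \<open>F\<close>, the closed form would give \<open>1\<close> instead of \<open>0\<close>; hence the recurrence
  read off from the denominator only holds from the coefficient of \<open>x^8\<close> on, and the earlier
  coefficients form the numerator.
\<close>

lemma fps_of_closed_form:
  fixes F :: "rat fps"
  assumes "fps_nth F 0 = 0"
    and "\<And>n. fps_nth F (Suc n) =
      ((of_nat n + 8) * of_nat (fib (n + 1)) + 15 * of_nat (fib (n + 2))
        + (of_nat n + 1) * of_nat (fib (n + 3))) / 5 - 1 - (of_nat n + 3) * (of_nat n + 2) / 2"
  shows "F = fps_X * (fps_X ^ 6 - fps_X ^ 5 - 3 * fps_X ^ 4 + fps_X ^ 3 + 3 * fps_X ^ 2 - 3 * fps_X + 1)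
             / ((1 - fps_X) ^ 3 * (1 - fps_X - fps_X ^ 2) ^ 2)"
    and "map (fps_nth F) [0..<11] = [0, 1, 2, 5, 12, 27, 56, 110, 207, 378, 675]"
proof -
  let ?X = "fps_X :: rat fps"
  let ?N = "?X * (?X ^ 6 - ?X ^ 5 - 3 * ?X ^ 4 + ?X ^ 3 + 3 * ?X ^ 2 - 3 * ?X + 1)"
  let ?D = "(1 - ?X) ^ 3 * (1 - ?X - ?X ^ 2) ^ 2"
  have vals: "fps_nth F 0 = 0" "fps_nth F 1 = 1" "fps_nth F 2 = 2" "fps_nth F 3 = 5"
      "fps_nth F 4 = 12" "fps_nth F 5 = 27" "fps_nth F 6 = 56" "fps_nth F 7 = 110"
      "fps_nth F 8 = 207" "fps_nth F 9 = 378" "fps_nth F 10 = 675"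
    using assms(1) by (simp_all add: assms(2) numeral_eq_Suc)
  show "map (fps_nth F) [0..<11] = [0, 1, 2, 5, 12, 27, 56, 110, 207, 378, 675]"
    using vals by (simp add: upt_rec numeral_eq_Suc)
  have D: "?D = 1 - fps_const 5 * ?X ^ 1 + fps_const 8 * ?X ^ 2 - fps_const 2 * ?X ^ 3
      - fps_const 6 * ?X ^ 4 + fps_const 4 * ?X ^ 5 + ?X ^ 6 - ?X ^ 7"
    unfolding numeral_fps_const[symmetric] by (rule denominator_expand)
  have N: "?N = ?X ^ 7 - ?X ^ 6 - fps_const 3 * ?X ^ 5 + ?X ^ 4 + fps_const 3 * ?X ^ 3
      - fps_const 3 * ?X ^ 2 + ?X ^ 1"
    unfolding numeral_fps_const[symmetric] by (rule numerator_expand)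
  have "?D * F = ?N"
  proof (rule fps_ext)
    fix n
    have *: "fps_nth (?D * F) n = fps_nth F n - 5 * fps_nth (?X ^ 1 * F) n
        + 8 * fps_nth (?X ^ 2 * F) n - 2 * fps_nth (?X ^ 3 * F) n - 6 * fps_nth (?X ^ 4 * F) n
        + 4 * fps_nth (?X ^ 5 * F) n + fps_nth (?X ^ 6 * F) n - fps_nth (?X ^ 7 * F) n"
      unfolding D by (simp only: distrib_right left_diff_distrib mult_1_left mult.assoc
          fps_add_nth fps_sub_nth fps_mult_left_const_nth)
    show "fps_nth (?D * F) n = fps_nth ?N n"
    proof (cases "n < 8")
      case True
      then consider "n = 0" | "n = 1" | "n = 2" | "n = 3" | "n = 4" | "n = 5" | "n = 6" | "n = 7"
        by linarith
      then show ?thesis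
        unfolding * N by cases (simp_all add: fps_X_power_mult_nth fps_X_power_nth vals vals(2)[unfolded One_nat_def])
    next
      case False
      then obtain m where m: "n = m + 8" using le_Suc_ex by (metis add.commute not_less)
      have s: "m + 8 = Suc (m + 7)" "m + 7 = Suc (m + 6)" "m + 6 = Suc (m + 5)"
          "m + 5 = Suc (m + 4)" "m + 4 = Suc (m + 3)" "m + 3 = Suc (m + 2)" "m + 2 = Suc (m + 1)"
          "m + 1 = Suc m"
        by simp_all
      have "fps_nth (?D * F) n = fps_nth F (m + 8) - 5 * fps_nth F (m + 7) + 8 * fps_nth F (m + 6)
          - 2 * fps_nth F (m + 5) - 6 * fps_nth F (m + 4) + 4 * fps_nth F (m + 3)
          + fps_nth F (m + 2) - fps_nth F (m + 1)"
        unfolding * unfolding m by (simp add: fps_X_power_mult_nth add.commute)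
      also have "\<dots> = 0"
        unfolding s assms(2) by (simp add: numeral_eq_Suc field_simps)
      also have "\<dots> = fps_nth ?N n"
        unfolding N m by (simp add: fps_X_power_nth)
      finally show ?thesis .
    qed
  qed
  moreover have "?D \<noteq> 0"
  proof
    assume "?D = 0"
    then have "fps_nth ?D 0 = 0" by simp
    then show False by (simp add: fps_nth_power_0)
  qed
  ultimately show "F = ?N / ?D" by (metis nonzero_mult_div_cancel_left)
qed

section \<open>Closed form and generating function of the avoiders\<close>

lemma card_inv_seqs_avoiding_closed_form:
  "(of_nat (card (inv_seqs_avoiding n {[1,0,0], [0,1,2]})) :: rat) =
     ((of_nat n + 8) * of_nat (fib (n + 1)) + 15 * of_nat (fib (n + 2))
        + (of_nat n + 1) * of_nat (fib (n + 3))) / 5 - 1 - (of_nat n + 3) * (of_nat n + 2) / 2"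
proof -
  let ?r = "of_nat :: nat \<Rightarrow> rat"
  define U where "U = (\<Sum>p\<le>n. \<Sum>j<Suc (n - p). p choose Suc j)"
  define V where "V = (\<Sum>p\<le>n. (n - p) * (\<Sum>j<n - p. p choose Suc j))"
  have "card (inv_seqs_avoiding n {[1,0,0], [0,1,2]}) = 1 + (U + V)"
    unfolding card_inv_seqs_avoiding U_def V_def sum.distrib ..
  then have "?r (card (inv_seqs_avoiding n {[1,0,0], [0,1,2]})) = 1 + (?r U + ?r V)"
    by (simp only: of_nat_add of_nat_1)
  moreover have "?r U + ?r n + 3 = ?r (fib (n + 4))"
    using sum_partial_binomials[of n, THEN arg_cong[of _ _ ?r]]
    unfolding U_def by (simp only: of_nat_add of_nat_numeral)
  moreover note sum_weighted_partial_binomials[of n, folded V_def]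
  ultimately show ?thesis by (simp add: field_simps)
qed

theorem theorem4p10:
  shows "inv_seqs_gf {[1,0,0], [0,1,2]} =
           fps_X * (fps_X ^ 6 - fps_X ^ 5 - 3 * fps_X ^ 4 + fps_X ^ 3 + 3 * fps_X ^ 2 - 3 * fps_X + 1)
             / ((1 - fps_X) ^ 3 * (1 - fps_X - fps_X ^ 2) ^ 2)
       \<and> map (fps_nth (inv_seqs_gf {[1,0,0], [0,1,2]})) [0..<11] =
           [0, 1, 2, 5, 12, 27, 56, 110, 207, 378, 675]
       \<and> (\<forall>n::nat. (of_nat (card (inv_seqs_avoiding n {[1,0,0], [0,1,2]})) :: rat) =
           ((of_nat (n + 1) + 7) * of_nat (fib (n + 1)) + 15 * of_nat (fib (n + 2))
              + of_nat (n + 1) * of_nat (fib (n + 3))) / 5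
             - 1 - of_nat ((n + 3) choose 2))"
proof (intro conjI allI)
  let ?F = "inv_seqs_gf {[1,0,0], [0,1,2]}"
  have F0: "fps_nth ?F 0 = 0" by (simp add: inv_seqs_gf_def)
  have F_Suc: "fps_nth ?F (Suc n) =
      ((of_nat n + 8) * of_nat (fib (n + 1)) + 15 * of_nat (fib (n + 2))
        + (of_nat n + 1) * of_nat (fib (n + 3))) / 5 - 1 - (of_nat n + 3) * (of_nat n + 2) / 2" for n
    unfolding card_inv_seqs_avoiding_closed_form[symmetric] inv_seqs_gf_def by simp
  show "?F = fps_X * (fps_X ^ 6 - fps_X ^ 5 - 3 * fps_X ^ 4 + fps_X ^ 3 + 3 * fps_X ^ 2 - 3 * fps_X + 1)
             / ((1 - fps_X) ^ 3 * (1 - fps_X - fps_X ^ 2) ^ 2)"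
    by (rule fps_of_closed_form(1)[OF F0 F_Suc])
  show "map (fps_nth ?F) [0..<11] = [0, 1, 2, 5, 12, 27, 56, 110, 207, 378, 675]"
    by (rule fps_of_closed_form(2)[OF F0 F_Suc])
  show "(of_nat (card (inv_seqs_avoiding n {[1,0,0], [0,1,2]})) :: rat) =
      ((of_nat (n + 1) + 7) * of_nat (fib (n + 1)) + 15 * of_nat (fib (n + 2))
        + of_nat (n + 1) * of_nat (fib (n + 3))) / 5 - 1 - of_nat ((n + 3) choose 2)" for n
    unfolding card_inv_seqs_avoiding_closed_form of_nat_choose_two by (simp add: algebra_simps)
qed

end
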